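(* Let $G$ be any finite simple graph with $\overline{\operatorname{meg}}(G)=0$ (equivalently, $\operatorname{meg}(G)=|G|$) and let $H$ be any finite simple graph. Then $\overline{\operatorname{meg}}(G\mathbin{\square} H)=\overline{\operatorname{meg}}(G\boxtimes H)=0$.
   Context: All graphs are finite and simple; $|G|$ denotes the number of vertices of $G$. The distance $\operatorname{dist}_G(u,v)$ is the length of a shortest path between $u$ and $v$ in $G$ (infinite if there is none). A set $S\subseteq V(G)$ monitors an edge $e\in E(G)$ if there are $u,v\in S$ with $\operatorname{dist}_{G-e}(u,v)\neq\operatorname{dist}_G(u,v)$, where $G-e$ is $G$ with the edge $e$ removed (its endpoints kept). A monitoring edge-geodetic set (MEG-set) of $G$ is a set of vertices that monitors every edge of $G$. The monitoring edge-geodetic number $\operatorname{meg}(G)$ is the minimum size of a MEG-set of $G$, and $\overline{\operatorname{meg}}(G)$ is the maximum order of the complement (in $V(G)$) of a MEG-set of $G$, i.e. $\overline{\operatorname{meg}}(G)=|G|-\operatorname{meg}(G)$. Both the Cartesian product $G\mathbin{\square} H$ and the strong product $G\boxtimes H$ have vertex set $V(G)\times V(H)$. The edges of $G\mathbin{\square} H$ are the pairs $(a,b)(c,d)$ such that either $a=c$ and $bd\in E(H)$, or $b=d$ and $ac\in E(G)$. The edges of $G\boxtimes H$ are the edges of $G\mathbin{\square} H$ together with the pairs $(a,b)(c,d)$ with $ac\in E(G)$ and $bd\in E(H)$. *)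

theory Defs
  imports "Graph_Theory.Pair_Digraph" "HOL-Library.Extended_Nat"
begin

text \<open>
  A finite simple graph is a \<^locale>\<open>pair_graph\<close>: a finite, loop-free, symmetric relation on a
  finite vertex set. The null graph is allowed. An undirected edge \<open>ab\<close> is represented by the two
  arcs \<open>(a, b)\<close> and \<open>(b, a)\<close>, so deleting an edge deletes both arcs.
\<close>

definition del_edge :: "'a pair_pre_digraph \<Rightarrow> 'a \<times> 'a \<Rightarrow> 'a pair_pre_digraph" where
  "del_edge G e = G\<lparr>parcs := parcs G - {e, prod.swap e}\<rparr>"

text \<open>The infimum of the empty set is \<open>\<infinity>\<close> in \<^typ>\<open>enat\<close>.\<close>

definition graph_dist :: "'a pair_pre_digraph \<Rightarrow> 'a \<Rightarrow> 'a \<Rightarrow> enat" where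
  "graph_dist G u v = (INF p \<in> {p. pre_digraph.apath (with_proj G) u p v}. enat (length p))"

definition monitors :: "'a pair_pre_digraph \<Rightarrow> 'a set \<Rightarrow> 'a \<times> 'a \<Rightarrow> bool" where
  "monitors G S e \<longleftrightarrow> (\<exists>u\<in>S. \<exists>v\<in>S. graph_dist (del_edge G e) u v \<noteq> graph_dist G u v)"

definition meg_set :: "'a pair_pre_digraph \<Rightarrow> 'a set \<Rightarrow> bool" where
  "meg_set G S \<longleftrightarrow> S \<subseteq> pverts G \<and> (\<forall>e\<in>parcs G. monitors G S e)"

definition meg :: "'a pair_pre_digraph \<Rightarrow> nat" where
  "meg G = Min {card S |S. meg_set G S}"

definition co_meg :: "'a pair_pre_digraph \<Rightarrow> nat" where
  "co_meg G = Max {card (pverts G - S) |S. meg_set G S}"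

definition cartesian_product ::
  "'a pair_pre_digraph \<Rightarrow> 'b pair_pre_digraph \<Rightarrow> ('a \<times> 'b) pair_pre_digraph" where
  "cartesian_product G H =
     \<lparr>pverts = pverts G \<times> pverts H,
      parcs = {((a, b), (c, d)) |a b c d.
        a \<in> pverts G \<and> c \<in> pverts G \<and> b \<in> pverts H \<and> d \<in> pverts H \<and>
        (a = c \<and> (b, d) \<in> parcs H \<or> b = d \<and> (a, c) \<in> parcs G)}\<rparr>"

definition strong_product ::
  "'a pair_pre_digraph \<Rightarrow> 'b pair_pre_digraph \<Rightarrow> ('a \<times> 'b) pair_pre_digraph" where
  "strong_product G H =
     \<lparr>pverts = pverts G \<times> pverts H,
      parcs = parcs (cartesian_product G H) \<union>
        {((a, b), (c, d)) |a b c d. (a, c) \<in> parcs G \<and> (b, d) \<in> parcs H}\<rparr>"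

lemma pair_graph_iff:
  "pair_graph G \<longleftrightarrow> finite (pverts G) \<and> parcs G \<subseteq> pverts G \<times> pverts G \<and>
     (\<forall>a. (a, a) \<notin> parcs G) \<and> (\<forall>a b. (a, b) \<in> parcs G \<longrightarrow> (b, a) \<in> parcs G)"
proof
  assume "pair_graph G"
  then interpret pair_graph G .
  show "finite (pverts G) \<and> parcs G \<subseteq> pverts G \<times> pverts G \<and>
     (\<forall>a. (a, a) \<notin> parcs G) \<and> (\<forall>a b. (a, b) \<in> parcs G \<longrightarrow> (b, a) \<in> parcs G)"
    using pair_finite_verts in_arcsD1 in_arcsD2 pair_no_loops pair_sym_arcs
    by (fastforce simp: symmetric_def sym_def)
next
  assume *: "finite (pverts G) \<and> parcs G \<subseteq> pverts G \<times> pverts G \<and>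
     (\<forall>a. (a, a) \<notin> parcs G) \<and> (\<forall>a b. (a, b) \<in> parcs G \<longrightarrow> (b, a) \<in> parcs G)"
  then have "finite (parcs G)"
    by (meson finite_SigmaI finite_subset)
  with * show "pair_graph G"
    by unfold_locales (auto simp: symmetric_def sym_def)
qed

lemma pair_graph_cartesian_product:
  assumes "pair_graph G" "pair_graph H"
  shows "pair_graph (cartesian_product G H)"
  using assms unfolding pair_graph_iff cartesian_product_def by auto

lemma pair_graph_strong_product:
  assumes "pair_graph G" "pair_graph H"
  shows "pair_graph (strong_product G H)"
  using assms unfolding pair_graph_iff strong_product_def cartesian_product_def by auto

lemma meg_set_pverts:
  assumes "pair_graph G"
  shows "meg_set G (pverts G)"
  unfolding meg_set_def
proof (intro conjI ballI)
  fix e assume e: "e \<in> parcs G"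
  obtain a b where ab: "e = (a, b)" by fastforce
  from assms e ab have V: "a \<in> pverts G" "b \<in> pverts G" "a \<noteq> b"
    by (auto simp: pair_graph_iff)
  have "pre_digraph.apath (with_proj G) a [(a, b)] b"
    using V e ab
    by (simp add: pre_digraph.apath_def pre_digraph.awalk_def pre_digraph.cas.simps
        pre_digraph.awalk_verts.simps)
  then have le: "graph_dist G a b \<le> 1"
    unfolding graph_dist_def by (rule INF_lower2[OF CollectI]) (simp add: one_enat_def)
  have "enat 2 \<le> graph_dist (del_edge G e) a b"
    unfolding graph_dist_def
  proof (rule INF_greatest)
    fix p assume "p \<in> {p. pre_digraph.apath (with_proj (del_edge G e)) a p b}"
    then have p: "set p \<subseteq> parcs G - {e, prod.swap e}" "pcas a p b"
      by (auto simp: pre_digraph.apath_def pre_digraph.awalk_def del_edge_def cas_with_proj_eq)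
    show "enat 2 \<le> enat (length p)"
    proof (cases p)
      case Nil
      with p V show ?thesis by simp
    next
      case (Cons x q)
      with p ab show ?thesis by (cases q; cases x) auto
    qed
  qed
  with le have "graph_dist (del_edge G e) a b \<noteq> graph_dist G a b"
    by (metis enat_ord_simps(1) le_trans not_less_eq_eq numeral_2_eq_2 one_enat_def One_nat_def
        order.trans order_refl)
  with V show "monitors G (pverts G) e"
    unfolding monitors_def by blast
qed simp

lemma co_meg_eq:
  assumes "pair_graph G"
  shows "co_meg G = card (pverts G) - meg G"
proof -
  have fin: "finite (pverts G)" using assms by (simp add: pair_graph_iff)
  let ?M = "{S. meg_set G S}"
  have sub: "?M \<subseteq> Pow (pverts G)" by (auto simp: meg_set_def)
  then have finM: "finite ?M" using fin by (meson finite_Pow_iff finite_subset)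
  have C: "{card S |S. meg_set G S} = card ` ?M"
    "{card (pverts G - S) |S. meg_set G S} = (\<lambda>S. card (pverts G - S)) ` ?M" by auto
  have ne: "?M \<noteq> {}" using meg_set_pverts[OF assms] by blast
  have "meg G \<in> card ` ?M"
    unfolding meg_def C using finM ne by (intro Min_in) auto
  then obtain S where S: "meg_set G S" "card S = meg G" by auto
  have diff: "card (pverts G - T) = card (pverts G) - card T" if "meg_set G T" for T
    using that fin by (meson card_Diff_subset finite_subset meg_set_def)
  show ?thesis
    unfolding co_meg_def C
  proof (rule Max_eqI)
    fix y assume "y \<in> (\<lambda>S. card (pverts G - S)) ` ?M"
    then obtain T where T: "meg_set G T" "y = card (pverts G - T)" by auto
    moreover have "meg G \<le> card T"
      unfolding meg_def C using finM T by (intro Min_le) auto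
    ultimately show "y \<le> card (pverts G) - meg G" using diff by simp
  next
    show "card (pverts G) - meg G \<in> (\<lambda>S. card (pverts G - S)) ` ?M"
      using S diff by force
  qed (use finM in simp)
qed

lemma meg_le_card:
  assumes "pair_graph G"
  shows "meg G \<le> card (pverts G)"
proof -
  have fin: "finite (pverts G)" using assms by (simp add: pair_graph_iff)
  have "{card S |S. meg_set G S} \<subseteq> {..card (pverts G)}"
    using fin by (auto simp: meg_set_def card_mono)
  then have "finite {card S |S. meg_set G S}" by (rule finite_subset) simp
  then show ?thesis
    unfolding meg_def using meg_set_pverts[OF assms] by (intro Min_le) auto
qed

lemma co_meg_eq_0_iff:
  assumes "pair_graph G"
  shows "co_meg G = 0 \<longleftrightarrow> meg G = card (pverts G)"
  using co_meg_eq[OF assms] meg_le_card[OF assms] by auto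

end

theory Submission
  imports Defs
begin

text \<open>
  The argument rests on a local description of the vertices that lie in every MEG-set. A vertex \<open>v\<close>
  has this property iff it has a neighbour \<open>u\<close> such that every geodesic that runs through the edge
  \<open>uv\<close> and continues beyond \<open>v\<close> can be rerouted around \<open>v\<close>: every neighbour \<open>x\<close> of \<open>v\<close> at distance 2
  from \<open>u\<close> has a common neighbour with \<open>u\<close> other than \<open>v\<close>.

  If there is such a \<open>u\<close>, then the edge \<open>uv\<close> can only be monitored by pairs of vertices that contain
  \<open>v\<close>, since for any other pair a geodesic through \<open>uv\<close> can be replaced by one of the same length
  that misses \<open>v\<close> (\<open>not_monitors_if_detour_neighbour\<close>). If there is none, then all vertices but \<open>v\<close>
  form a MEG-set: an edge away from \<open>v\<close> is monitored by its own ends, and an edge \<open>uv\<close> by \<open>u\<close>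
  and a vertex \<open>x\<close> for which the path \<open>u v x\<close> is the only geodesic from \<open>u\<close> to \<open>x\<close>
  (\<open>meg_set_minus_vertex\<close>). Hence \<open>co_meg G = 0\<close> says that every vertex of \<open>G\<close> has such a neighbour
  (\<open>co_meg_eq_0_iff_detour_neighbour\<close>).

  This condition passes from \<open>G\<close> to both products: if \<open>u\<close> serves for \<open>g\<close> in \<open>G\<close>, then \<open>(u, h)\<close>
  serves for \<open>(g, h)\<close>.
\<close>

section \<open>Monitoring in terms of walks\<close>

text \<open>
  A shortest walk is a path, so distances can be computed from relation powers of the arc set,
  which count walks of a given length and are easier to cut and splice than paths.
\<close>

lemma graph_dist_le_iff_relpow:
  assumes "pair_graph G" and "a \<in> pverts G"
  shows "graph_dist G a b \<le> enat n \<longleftrightarrow> (\<exists>m\<le>n. (a, b) \<in> parcs G ^^ m)"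
proof -
  interpret pair_graph G by fact
  have awalk_if_relpow: "\<exists>p. awalk a p c \<and> length p = m" if "(a, c) \<in> parcs G ^^ m" for m c
    using that
  proof (induction m arbitrary: c)
    case 0
    then show ?case using assms(2) by (auto simp: awalk_Nil_iff)
  next
    case (Suc m)
    then obtain d where d: "(a, d) \<in> parcs G ^^ m" "(d, c) \<in> parcs G" by auto
    with Suc obtain p where p: "awalk a p d" "length p = m" by blast
    have "awalk d [(d, c)] c"
      using d(2) arc_implies_awalk[of "(d, c)"] by simp
    then have "awalk a (p @ [(d, c)]) c" using p(1) by (rule awalk_appendI[rotated])
    with p(2) show ?case by (intro exI[of _ "p @ [(d, c)]"]) simp
  qed
  have relpow_if_awalk: "(c, b) \<in> parcs G ^^ length p" if "awalk c p b" for c p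
    using that
  proof (induction p arbitrary: c)
    case (Cons e p)
    then have "(c, snd e) \<in> parcs G" "awalk (snd e) p b"
      by (auto simp: awalk_Cons_iff)
    then show ?case using relpow_Suc_I2[OF _ Cons.IH] by simp
  qed (auto simp: awalk_Nil_iff)
  show ?thesis
  proof
    assume "graph_dist G a b \<le> enat n"
    then have "graph_dist G a b < enat (Suc n)"
      by (rule order_le_less_trans) simp
    then obtain p where "apath a p b" "length p < Suc n"
      unfolding graph_dist_def INF_less_iff by auto
    then show "\<exists>m\<le>n. (a, b) \<in> parcs G ^^ m"
      using relpow_if_awalk[of a p] by (intro exI[of _ "length p"]) (simp add: apath_def)
  next
    assume "\<exists>m\<le>n. (a, b) \<in> parcs G ^^ m"
    then obtain p where p: "awalk a p b" "length p \<le> n" using awalk_if_relpow by blast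
    have path: "apath a (awalk_to_apath p) b" using p(1) by (rule apath_awalk_to_apath)
    \<comment> \<open>The path repeats no arc and takes its arcs from \<open>p\<close>, hence it is no longer than \<open>p\<close>.\<close>
    then have "distinct (awalk_to_apath p)"
      unfolding apath_def by (blast intro: distinct_verts_imp_distinct)
    then have "length (awalk_to_apath p) = card (set (awalk_to_apath p))"
      by (rule distinct_card[symmetric])
    also have "\<dots> \<le> card (set p)"
      using awalk_to_apath_subset[OF p(1)] by (intro card_mono) auto
    also have "\<dots> \<le> n"
      using card_length[of p] p(2) by linarith
    finally have "length (awalk_to_apath p) \<le> n" .
    with path show "graph_dist G a b \<le> enat n"
      unfolding graph_dist_def by (intro INF_lower2[where i = "awalk_to_apath p"]) auto
  qed
qed

lemma pair_graph_del_edge: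
  assumes "pair_graph G"
  shows "pair_graph (del_edge G e)"
  using assms unfolding pair_graph_iff del_edge_def by (cases e) auto

lemma relpow_del_edge_subset: "parcs (del_edge G e) ^^ n \<subseteq> parcs G ^^ n"
  by (induction n) (auto simp: del_edge_def)

text \<open>
  Since deleting an edge can only lengthen distances, a pair detects the deletion iff none of its
  geodesics survives.
\<close>

lemma monitors_iff_relpow:
  assumes "pair_graph G" and "S \<subseteq> pverts G"
  shows "monitors G S e \<longleftrightarrow>
    (\<exists>a\<in>S. \<exists>b\<in>S. \<exists>n. (a, b) \<in> parcs G ^^ n \<and> (\<forall>m<n. (a, b) \<notin> parcs G ^^ m) \<and>
      (a, b) \<notin> parcs (del_edge G e) ^^ n)"
proof -
  have "graph_dist (del_edge G e) a b \<noteq> graph_dist G a b \<longleftrightarrow>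
    (\<exists>n. (a, b) \<in> parcs G ^^ n \<and> (\<forall>m<n. (a, b) \<notin> parcs G ^^ m) \<and>
      (a, b) \<notin> parcs (del_edge G e) ^^ n)" (is "?L \<longleftrightarrow> (\<exists>n. ?P n)") if "a \<in> S" for a b
  proof -
    have a: "a \<in> pverts G" "a \<in> pverts (del_edge G e)"
      using that assms(2) by (auto simp: del_edge_def)
    note le = graph_dist_le_iff_relpow[OF assms(1) a(1)]
    note le' = graph_dist_le_iff_relpow[OF pair_graph_del_edge[OF assms(1)] a(2)]
    have mono: "graph_dist G a b \<le> enat n" if "graph_dist (del_edge G e) a b \<le> enat n" for n
      using that relpow_del_edge_subset unfolding le le' by blast
    show ?thesis
    proof
      assume ne: ?L
      have "graph_dist G a b \<noteq> \<infinity>"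
      proof
        assume inf: "graph_dist G a b = \<infinity>"
        with ne obtain k where "graph_dist (del_edge G e) a b = enat k" by auto
        with mono[of k] inf show False by simp
      qed
      then obtain n where n: "graph_dist G a b = enat n" by auto
      have least: "(a, b) \<notin> parcs G ^^ m" if "m < n" for m
        using le[of b m] n that by auto
      have "(a, b) \<in> parcs G ^^ n"
        using le[of b n] n least by (metis le_neq_implies_less order_refl)
      moreover have "(a, b) \<notin> parcs (del_edge G e) ^^ n"
      proof
        assume "(a, b) \<in> parcs (del_edge G e) ^^ n"
        then have "graph_dist (del_edge G e) a b \<le> enat n" using le' by blast
        moreover from this obtain k where "graph_dist (del_edge G e) a b = enat k" "k \<le> n"
          by (cases "graph_dist (del_edge G e) a b") auto
        ultimately show False using ne n mono[of k] by auto
      qed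
      ultimately show "\<exists>n. ?P n" using least by blast
    next
      assume "\<exists>n. ?P n"
      then obtain n where n: "?P n" by blast
      then have "graph_dist G a b \<le> enat n" using le by blast
      moreover have "\<not> graph_dist (del_edge G e) a b \<le> enat n"
        using n relpow_del_edge_subset unfolding le' by (metis le_neq_implies_less subsetD)
      ultimately show ?L by auto
    qed
  qed
  then show ?thesis unfolding monitors_def by blast
qed

section \<open>Vertices in every MEG-set\<close>

definition detour_neighbour :: "'a pair_pre_digraph \<Rightarrow> 'a \<Rightarrow> 'a \<Rightarrow> bool" where
  "detour_neighbour G v u \<longleftrightarrow> (v, u) \<in> parcs G \<and>
     (\<forall>x. (v, x) \<in> parcs G \<longrightarrow> x \<noteq> u \<longrightarrow> (u, x) \<notin> parcs G \<longrightarrow>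
       (\<exists>w. w \<noteq> v \<and> (u, w) \<in> parcs G \<and> (w, x) \<in> parcs G))"

text \<open>
  Splicing a walk of length \<open>k\<close> into a shortest walk cannot shorten it. The cases \<open>k = 0\<close> and
  \<open>k = 1\<close> say that a geodesic has no repeated vertices and no chords.
\<close>

lemma geodesic_no_shortcut:
  assumes walk: "\<And>i. i < n \<Longrightarrow> (f i, f (Suc i)) \<in> R"
    and short: "\<And>m. m < n \<Longrightarrow> (f 0, f n) \<notin> R ^^ m"
    and "i \<le> j" "j \<le> n" and k: "(f i, f j) \<in> R ^^ k"
  shows "j \<le> i + k"
proof (rule ccontr)
  assume "\<not> j \<le> i + k"
  have "(f p, f (p + q)) \<in> R ^^ q" if "p + q \<le> n" for p q
    using that
  proof (induction q)
    case (Suc q)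
    then have "(f p, f (p + q)) \<in> R ^^ q" "(f (p + q), f (Suc (p + q))) \<in> R"
      using walk[of "p + q"] by auto
    then show ?case by (auto simp: relcomp_unfold)
  qed auto
  from this[of 0 i] this[of j "n - j"] have "(f 0, f i) \<in> R ^^ i" "(f j, f n) \<in> R ^^ (n - j)"
    using assms(3,4) by auto
  with k have "(f 0, f n) \<in> R ^^ (i + k + (n - j))"
    by (auto simp: relpow_add)
  moreover have "i + k + (n - j) < n"
    using \<open>\<not> j \<le> i + k\<close> assms(4) by linarith
  ultimately show False using short by blast
qed

text \<open>
  A geodesic between vertices other than \<open>v\<close> that uses the edge \<open>uv\<close> passes from \<open>u\<close> through \<open>v\<close> to
  some \<open>x\<close>, or the other way round. The detour around \<open>v\<close> gives a geodesic that survives the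
  deletion of \<open>uv\<close>.
\<close>

lemma not_monitors_if_detour_neighbour:
  assumes G: "pair_graph G" and det: "detour_neighbour G v u"
    and S: "S \<subseteq> pverts G" "v \<notin> S"
  shows "\<not> monitors G S (v, u)"
proof
  let ?R = "parcs G"
  let ?R' = "parcs (del_edge G (v, u))"
  have R': "(c, d) \<in> ?R'" if "(c, d) \<in> ?R" "c \<noteq> v \<and> d \<noteq> v" for c d
    using that by (auto simp: del_edge_def)
  have sym: "(d, c) \<in> ?R" if "(c, d) \<in> ?R" for c d
    using that G by (auto simp: pair_graph_iff)
  assume "monitors G S (v, u)"
  then obtain a b n where ab: "a \<in> S" "b \<in> S" "(a, b) \<in> ?R ^^ n"
    and short: "\<And>m. m < n \<Longrightarrow> (a, b) \<notin> ?R ^^ m" and no: "(a, b) \<notin> ?R' ^^ n"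
    unfolding monitors_iff_relpow[OF G S(1)] by blast
  then obtain f where f: "f 0 = a" "f n = b" and walk: "\<And>i. i < n \<Longrightarrow> (f i, f (Suc i)) \<in> ?R"
    unfolding relpow_fun_conv by blast
  have shortcut: "j \<le> i + k" if "i \<le> j" "j \<le> n" "(f i, f j) \<in> ?R ^^ k" for i j k
    using geodesic_no_shortcut[OF walk _ that] short f by blast
  from no f have "\<not> (\<forall>i<n. (f i, f (Suc i)) \<in> ?R')"
    unfolding relpow_fun_conv by blast
  then obtain i where i: "i < n" "(f i, f (Suc i)) \<in> ?R - ?R'"
    using walk by blast
  then have "f i = v \<and> f (Suc i) = u \<or> f i = u \<and> f (Suc i) = v"
    by (auto simp: del_edge_def)
  moreover have ends: "f 0 \<noteq> v" "f n \<noteq> v" using f ab(1,2) S(2) by auto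
  ultimately obtain j where j: "Suc j < n" "f (Suc j) = v"
    and u: "f j = u \<or> f (Suc (Suc j)) = u"
  proof (elim disjE conjE)
    assume fi: "f i = v" "f (Suc i) = u"
    with ends obtain j where "i = Suc j" by (cases i) auto
    with fi i(1) show thesis using that[of j] by auto
  next
    assume "f i = u" "f (Suc i) = v"
    moreover from this ends i(1) have "Suc i < n" by (metis Suc_lessI)
    ultimately show thesis using that[of i] by auto
  qed
  let ?p = "f j" and ?q = "f (Suc (Suc j))"
  have pq: "(v, ?p) \<in> ?R" "(v, ?q) \<in> ?R"
    using walk[of j] walk[of "Suc j"] j sym by auto
  have "?p \<noteq> ?q" using shortcut[of j "Suc (Suc j)" 0] j by auto
  moreover have "(?p, ?q) \<notin> ?R" using shortcut[of j "Suc (Suc j)" 1] j by auto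
  ultimately obtain w where w: "w \<noteq> v" "(?p, w) \<in> ?R" "(w, ?q) \<in> ?R"
    using det u pq sym unfolding detour_neighbour_def by metis
  \<comment> \<open>The geodesic visits \<open>v\<close> only once, so replacing this visit by \<open>w\<close> leaves no arc at \<open>v\<close>.\<close>
  define g where "g = f(Suc j := w)"
  have once: "i = Suc j" if "i \<le> n" "f i = v" for i
    using shortcut[of i "Suc j" 0] shortcut[of "Suc j" i 0] that j by force
  then have "g i \<noteq> v" if "i \<le> n" for i
    using that w(1) unfolding g_def by auto
  moreover have "(g i, g (Suc i)) \<in> ?R" if "i < n" for i
    using walk[OF that] w(2,3) unfolding g_def by auto
  ultimately have "\<forall>i<n. (g i, g (Suc i)) \<in> ?R'"
    using R' by (metis Suc_leI less_imp_le)
  moreover have "g 0 = a" "g n = b" using f j unfolding g_def by auto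
  ultimately show False using no unfolding relpow_fun_conv by blast
qed

text \<open>
  Here every edge \<open>uv\<close> extends to a path \<open>u v x\<close> that is the only geodesic from \<open>u\<close> to \<open>x\<close>, so \<open>u\<close>
  and \<open>x\<close> monitor \<open>uv\<close> in place of \<open>v\<close>.
\<close>

lemma meg_set_minus_vertex:
  assumes G: "pair_graph G" and no: "\<And>u. \<not> detour_neighbour G v u"
  shows "meg_set G (pverts G - {v})"
  unfolding meg_set_def
proof (intro conjI ballI)
  let ?R = "parcs G"
  let ?S = "pverts G - {v}"
  note mon = monitors_iff_relpow[OF G, of ?S, OF Diff_subset]
  have V: "c \<in> pverts G" "d \<in> pverts G" "c \<noteq> d" "(d, c) \<in> ?R" if "(c, d) \<in> ?R" for c d
    using that G by (auto simp: pair_graph_iff)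
  have at_v: "monitors G ?S e" if vu: "(v, u) \<in> ?R" and e: "e = (v, u) \<or> e = (u, v)" for u e
  proof -
    from no[of u] vu obtain x where x: "(v, x) \<in> ?R" "x \<noteq> u" "(u, x) \<notin> ?R"
      and only: "\<And>w. (u, w) \<in> ?R \<Longrightarrow> (w, x) \<in> ?R \<Longrightarrow> w = v"
      unfolding detour_neighbour_def by blast
    have S: "u \<in> ?S" "x \<in> ?S" using V[OF vu] V[OF x(1)] by auto
    have two: "(c, d) \<in> Q ^^ 2 \<longleftrightarrow> (\<exists>w. (c, w) \<in> Q \<and> (w, d) \<in> Q)" for c d and Q :: "'a rel"
      by (auto simp: numeral_2_eq_2)
    have "(u, x) \<in> ?R ^^ 2" using V[OF vu] x(1) unfolding two by blast
    moreover have "(u, x) \<notin> ?R ^^ m" if "m < 2" for m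
      using that x by (auto simp: less_2_cases_iff)
    moreover have "(u, x) \<notin> parcs (del_edge G e) ^^ 2"
      using only e unfolding two del_edge_def by auto
    ultimately show ?thesis unfolding mon using S by blast
  qed
  fix e assume e: "e \<in> ?R"
  obtain c d where cd: "e = (c, d)" by fastforce
  show "monitors G ?S e"
  proof (cases "c = v \<or> d = v")
    case True
    then show ?thesis
    proof
      assume "c = v"
      then show ?thesis using at_v[of d e] e cd by simp
    next
      assume "d = v"
      then show ?thesis using at_v[of c e] V(4)[of c d] e cd by simp
    qed
  next
    case False
    then have S: "c \<in> ?S" "d \<in> ?S" using V e cd by auto
    have "(c, d) \<in> ?R ^^ 1" using e cd by simp
    moreover have "\<forall>m<1. (c, d) \<notin> ?R ^^ m" using V e cd by auto
    moreover have "(c, d) \<notin> parcs (del_edge G e) ^^ 1" using cd by (simp add: del_edge_def)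
    ultimately show ?thesis unfolding mon using S by blast
  qed
qed auto

lemma co_meg_eq_0_iff_meg_set_unique:
  assumes "pair_graph G"
  shows "co_meg G = 0 \<longleftrightarrow> (\<forall>S. meg_set G S \<longrightarrow> S = pverts G)"
proof -
  have fin: "finite (pverts G)" using assms by (simp add: pair_graph_iff)
  let ?C = "{card (pverts G - S) |S. meg_set G S}"
  have "?C \<subseteq> {..card (pverts G)}" using fin by (auto intro: card_mono)
  then have finC: "finite ?C" by (rule finite_subset) simp
  moreover have "?C \<noteq> {}" using meg_set_pverts[OF assms] by blast
  ultimately have "co_meg G = 0 \<longleftrightarrow> (\<forall>c\<in>?C. c = 0)"
    unfolding co_meg_def by (metis (no_types, lifting) Max_ge Max_in le_zero_eq)
  also have "\<dots> \<longleftrightarrow> (\<forall>S. meg_set G S \<longrightarrow> card (pverts G - S) = 0)"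
    by auto
  also have "\<dots> \<longleftrightarrow> (\<forall>S. meg_set G S \<longrightarrow> pverts G - S = {})"
    using fin by (simp only: card_0_eq finite_Diff)
  also have "\<dots> \<longleftrightarrow> (\<forall>S. meg_set G S \<longrightarrow> S = pverts G)"
    by (auto simp: meg_set_def)
  finally show ?thesis .
qed

theorem co_meg_eq_0_iff_detour_neighbour:
  assumes "pair_graph G"
  shows "co_meg G = 0 \<longleftrightarrow> (\<forall>v\<in>pverts G. \<exists>u. detour_neighbour G v u)"
  unfolding co_meg_eq_0_iff_meg_set_unique[OF assms]
proof (intro iffI ballI allI impI)
  fix v assume "\<forall>S. meg_set G S \<longrightarrow> S = pverts G" "v \<in> pverts G"
  then show "\<exists>u. detour_neighbour G v u"
    using meg_set_minus_vertex[OF assms, of v] by blast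
next
  fix S assume det: "\<forall>v\<in>pverts G. \<exists>u. detour_neighbour G v u" and S: "meg_set G S"
  have "v \<in> S" if v: "v \<in> pverts G" for v
  proof (rule ccontr)
    assume "v \<notin> S"
    from det v obtain u where u: "detour_neighbour G v u" by blast
    then have "monitors G S (v, u)"
      using S by (simp add: meg_set_def detour_neighbour_def)
    with not_monitors_if_detour_neighbour[OF assms u _ \<open>v \<notin> S\<close>] S show False
      by (simp add: meg_set_def)
  qed
  with S show "S = pverts G" by (auto simp: meg_set_def)
qed

section \<open>Products\<close>

text \<open>
  A neighbour \<open>(x, h)\<close> of \<open>(g, h)\<close> is handled inside the copy of \<open>G\<close> at \<open>h\<close>; a neighbour \<open>(g, y)\<close>
  closes a 4-cycle through \<open>(u, y)\<close>.
\<close>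

lemma detour_neighbour_cartesian_product:
  assumes G: "pair_graph G" and H: "pair_graph H"
    and det: "detour_neighbour G g u" and h: "h \<in> pverts H"
  shows "detour_neighbour (cartesian_product G H) (g, h) (u, h)"
proof -
  let ?P = "parcs (cartesian_product G H)"
  have arc: "((a, b), (c, d)) \<in> ?P \<longleftrightarrow> a \<in> pverts G \<and> c \<in> pverts G \<and> b \<in> pverts H \<and> d \<in> pverts H \<and>
      (a = c \<and> (b, d) \<in> parcs H \<or> b = d \<and> (a, c) \<in> parcs G)" for a b c d
    by (simp add: cartesian_product_def)
  have gu: "(g, u) \<in> parcs G" using det by (simp add: detour_neighbour_def)
  have V: "c \<in> pverts G" "d \<in> pverts G" "c \<noteq> d" "(d, c) \<in> parcs G" if "(c, d) \<in> parcs G" for c d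
    using that G by (auto simp: pair_graph_iff)
  have "\<exists>w. w \<noteq> (g, h) \<and> ((u, h), w) \<in> ?P \<and> (w, (x, y)) \<in> ?P"
    if xy: "((g, h), (x, y)) \<in> ?P" "(x, y) \<noteq> (u, h)" "((u, h), (x, y)) \<notin> ?P" for x y
  proof -
    from xy(1) consider "x = g" "(h, y) \<in> parcs H" | "y = h" "(g, x) \<in> parcs G"
      unfolding arc by blast
    then show ?thesis
    proof cases
      case 1
      then have "y \<in> pverts H" using H by (auto simp: pair_graph_iff)
      with 1 have "((u, h), (u, y)) \<in> ?P" "((u, y), (x, y)) \<in> ?P"
        unfolding arc using V[OF gu] h by auto
      moreover have "(u, y) \<noteq> (g, h)" using V[OF gu] by simp
      ultimately show ?thesis by blast
    next
      case 2
      with xy(2,3) have "x \<noteq> u" "(u, x) \<notin> parcs G"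
        unfolding arc using V[OF gu] V[OF 2(2)] h by auto
      with det 2(2) obtain w where w: "w \<noteq> g" "(u, w) \<in> parcs G" "(w, x) \<in> parcs G"
        unfolding detour_neighbour_def by blast
      then have "((u, h), (w, h)) \<in> ?P" "((w, h), (x, y)) \<in> ?P"
        unfolding arc using V h 2(1) by auto
      moreover have "(w, h) \<noteq> (g, h)" using w(1) by simp
      ultimately show ?thesis by blast
    qed
  qed
  moreover have "((g, h), (u, h)) \<in> ?P" unfolding arc using gu V h by auto
  ultimately show ?thesis unfolding detour_neighbour_def by auto
qed

text \<open>
  A neighbour \<open>(x, y)\<close> of \<open>(g, h)\<close> with \<open>x\<close> equal or adjacent to \<open>u\<close> is itself equal or adjacent to
  \<open>(u, h)\<close>, because \<open>y\<close> is \<open>h\<close> or a neighbour of \<open>h\<close>. For the other \<open>(x, y)\<close>, a common neighbour \<open>w\<close>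
  of \<open>u\<close> and \<open>x\<close> yields the common neighbour \<open>(w, h)\<close>.
\<close>

lemma detour_neighbour_strong_product:
  assumes G: "pair_graph G" and H: "pair_graph H"
    and det: "detour_neighbour G g u" and h: "h \<in> pverts H"
  shows "detour_neighbour (strong_product G H) (g, h) (u, h)"
proof -
  let ?P = "parcs (strong_product G H)"
  have arc: "((a, b), (c, d)) \<in> ?P \<longleftrightarrow> a \<in> pverts G \<and> b \<in> pverts H \<and>
      (a = c \<and> (b, d) \<in> parcs H \<or> b = d \<and> (a, c) \<in> parcs G \<or>
       (a, c) \<in> parcs G \<and> (b, d) \<in> parcs H)" for a b c d
    using G H by (auto simp: strong_product_def cartesian_product_def pair_graph_iff)
  have gu: "(g, u) \<in> parcs G" using det by (simp add: detour_neighbour_def)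
  have V: "c \<in> pverts G" "d \<in> pverts G" "(d, c) \<in> parcs G" if "(c, d) \<in> parcs G" for c d
    using that G by (auto simp: pair_graph_iff)
  have "\<exists>w. w \<noteq> (g, h) \<and> ((u, h), w) \<in> ?P \<and> (w, (x, y)) \<in> ?P"
    if xy: "((g, h), (x, y)) \<in> ?P" "(x, y) \<noteq> (u, h)" "((u, h), (x, y)) \<notin> ?P" for x y
  proof -
    from xy(1) have y: "y = h \<or> (h, y) \<in> parcs H" unfolding arc by blast
    with xy(2,3) have "x \<noteq> u" "(u, x) \<notin> parcs G"
      unfolding arc using V[OF gu] h by auto
    moreover from this have "x \<noteq> g" using V[OF gu] by blast
    then have "(g, x) \<in> parcs G" using xy(1) unfolding arc by blast
    ultimately obtain w where w: "w \<noteq> g" "(u, w) \<in> parcs G" "(w, x) \<in> parcs G"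
      using det unfolding detour_neighbour_def by blast
    then have "((u, h), (w, h)) \<in> ?P" "((w, h), (x, y)) \<in> ?P"
      unfolding arc using V h y by auto
    moreover have "(w, h) \<noteq> (g, h)" using w(1) by simp
    ultimately show ?thesis by blast
  qed
  moreover have "((g, h), (u, h)) \<in> ?P" unfolding arc using gu V h by auto
  ultimately show ?thesis unfolding detour_neighbour_def by auto
qed

theorem corollary2:
  fixes G :: "'a pair_pre_digraph" and H :: "'b pair_pre_digraph"
  assumes "pair_graph G" and "pair_graph H"
    and "co_meg G = 0"
  shows "co_meg (cartesian_product G H) = 0 \<and> co_meg (strong_product G H) = 0"
proof -
  have det: "\<exists>u. detour_neighbour G g u" if "g \<in> pverts G" for g
    using that assms(3) co_meg_eq_0_iff_detour_neighbour[OF assms(1)] by blast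
  have verts: "pverts (cartesian_product G H) = pverts G \<times> pverts H"
    "pverts (strong_product G H) = pverts G \<times> pverts H"
    by (simp_all add: cartesian_product_def strong_product_def)
  show ?thesis
    unfolding verts co_meg_eq_0_iff_detour_neighbour[OF pair_graph_cartesian_product[OF assms(1,2)]]
      co_meg_eq_0_iff_detour_neighbour[OF pair_graph_strong_product[OF assms(1,2)]]
    using det detour_neighbour_cartesian_product[OF assms(1,2)]
      detour_neighbour_strong_product[OF assms(1,2)]
    by blast
qed

end
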